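(* Let $\sigma:\mathbb{R}\to\mathbb{R}$ be analytic with $\sigma\ge c_0$ on $\mathbb{R}$ for some constant $c_0>0$, and let $\overline\alpha\in\mathbb{R}$ be a critical point of $\sigma$, i.e. $\sigma'(\overline\alpha)=0$. Then there exist $\frac12<\gamma\le1$, $C>0$ and $\delta>0$ such that for every smooth periodic function $u:(0,1)\to\mathbb{R}$ and every $\alpha\in\mathbb{R}$ with $\|u\|_{H^2_{\mathrm{per.ave}}(0,1)}<\delta$ and $|\alpha-\overline\alpha|<\delta$, $$\sigma(\alpha)\,L\le\sigma(\overline\alpha)+C\left(\sigma(\alpha)^2\left\|\left(\frac{u_x}{\sqrt{1+u_x^2}}\right)_x\right\|_{L^2(0,1)}^2+|\sigma'(\alpha)|^2L^2\right)^{\gamma},$$ where $L=\int_0^1\sqrt{1+u_x^2}\,dx$ is the length of the graph of $u$.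
   Context: A smooth periodic function on $(0,1)$ means the restriction of a smooth $1$-periodic function on $\mathbb{R}$, i.e. a smooth function on $\mathbb{T}=\mathbb{R}/\mathbb{Z}$. The quantity $\|u\|_{H^2_{\mathrm{per.ave}}(0,1)}$ is $\left(\int_0^1u_x^2\,dx+\int_0^1u_{xx}^2\,dx\right)^{1/2}$. *)

theory Defs
  imports "HOL-Analysis.Analysis"
begin

text \<open>The library's \<open>analytic_on\<close> is for complex functions only.\<close>

definition real_analytic :: "(real \<Rightarrow> real) \<Rightarrow> bool" where
  "real_analytic f \<longleftrightarrow>
     (\<forall>x0. \<exists>r>0. \<exists>a :: nat \<Rightarrow> real.
        \<forall>x. \<bar>x - x0\<bar> < r \<longrightarrow> (\<lambda>n. a n * (x - x0) ^ n) sums f x)"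

definition smooth_real :: "(real \<Rightarrow> real) \<Rightarrow> bool" where
  "smooth_real f \<longleftrightarrow> (\<forall>n x. (deriv ^^ n) f field_differentiable (at x))"

text \<open>
  A function on \<open>(0,1)\<close> is a total function whose values outside \<open>(0,1)\<close> are irrelevant:
  all the quantities below only involve \<open>u\<close> and its derivatives at points of this
  open interval.
\<close>

definition smooth_periodic_01 :: "(real \<Rightarrow> real) \<Rightarrow> bool" where
  "smooth_periodic_01 u \<longleftrightarrow>
     (\<exists>v. smooth_real v \<and> (\<forall>x. v (x + 1) = v x) \<and> (\<forall>x\<in>{0<..<1}. u x = v x))"

definition L2_norm_01 :: "(real \<Rightarrow> real) \<Rightarrow> real" where
  "L2_norm_01 f = sqrt (LBINT x:{0<..<1}. (f x)\<^sup>2)"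

definition H2_per_ave_norm :: "(real \<Rightarrow> real) \<Rightarrow> real" where
  "H2_per_ave_norm u =
     sqrt ((LBINT x:{0<..<1}. (deriv u x)\<^sup>2) + (LBINT x:{0<..<1}. (deriv (deriv u) x)\<^sup>2))"

definition graph_length :: "(real \<Rightarrow> real) \<Rightarrow> real" where
  "graph_length u = (LBINT x:{0<..<1}. sqrt (1 + (deriv u x)\<^sup>2))"

definition graph_curvature :: "(real \<Rightarrow> real) \<Rightarrow> real \<Rightarrow> real" where
  "graph_curvature u = deriv (\<lambda>x. deriv u x / sqrt (1 + (deriv u x)\<^sup>2))"

end

theory Submission
  imports Defs
begin

text \<open>
  Write \<open>\<sigma> \<alpha> * L - \<sigma> \<alpha>bar = \<sigma> \<alpha> * (L - 1) + (\<sigma> \<alpha> - \<sigma> \<alpha>bar)\<close>. Since \<open>u\<^sub>x\<close> has mean zero,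
  it vanishes somewhere, so \<open>u\<^sub>x\<^sup>2\<close> is bounded by the integral \<open>Z\<close> of \<open>u\<^sub>x\<^sub>x\<^sup>2\<close>; hence \<open>L - 1\<close> is
  at most \<open>Z / 2\<close>, while for \<open>Z \<le> 1\<close> the squared \<open>L\<^sup>2\<close> norm of the curvature is at least \<open>Z / 8\<close>.
  The second summand is controlled by the one-dimensional Lojasiewicz inequality: if \<open>\<sigma> - \<sigma> \<alpha>bar\<close>
  vanishes to order \<open>k \<ge> 2\<close> at \<open>\<alpha>bar\<close>, then \<open>\<sigma>'\<close> vanishes to order \<open>k - 1\<close>, which gives the
  exponent \<open>\<gamma> = k / (2 * (k - 1))\<close>.
\<close>

section \<open>The one-dimensional Lojasiewicz inequality\<close>

text \<open>Dropping the \<open>m\<close> vanishing coefficients and dividing by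
  \<open>h ^ m\<close> leaves a power series that converges on the same interval, and a convergent
  power series is continuous at its centre. Applied below both to \<open>f - f p\<close> and to its
  derivative.\<close>

lemma power_series_factor_power:
  fixes a :: "nat \<Rightarrow> real"
  assumes "r > 0"
    and sums: "\<And>h. \<bar>h\<bar> < r \<Longrightarrow> (\<lambda>n. a n * h ^ n) sums f h"
    and zero: "\<And>i. i < m \<Longrightarrow> a i = 0"
  obtains g where "isCont g 0" "g 0 = a m" "\<And>h. \<bar>h\<bar> < r \<Longrightarrow> f h = h ^ m * g h"
proof -
  define b where "b = (\<lambda>n. a (n + m))"
  define g where "g = (\<lambda>h. \<Sum>n. b n * h ^ n)"
  have tail: "(\<lambda>n. b n * h ^ n * h ^ m) sums f h" if "\<bar>h\<bar> < r" for h
  proof -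
    have "(\<lambda>n. a (n + m) * h ^ (n + m)) sums (f h - (\<Sum>i<m. a i * h ^ i))"
      using sums[OF that] by (rule sums_split_initial_segment)
    then show ?thesis
      by (simp add: zero b_def power_add mult.assoc)
  qed
  \<comment> \<open>Dividing by \<open>h ^ m\<close> requires \<open>h \<noteq> 0\<close>; at the
    centre every power series is summable.\<close>
  have summable: "summable (\<lambda>n. b n * h ^ n)" if "\<bar>h\<bar> < r" for h
  proof (cases "h = 0")
    case False
    then show ?thesis
      using summable_mult2[OF sums_summable[OF tail[OF that]], of "inverse (h ^ m)"]
      by (simp add: mult.assoc)
  qed (simp add: summable_0_powser)
  have "isCont g 0"
    unfolding g_def
    by (rule isCont_powser[where K = "r / 2"]) (use summable[of "r / 2"] \<open>r > 0\<close> in auto)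
  moreover have "g 0 = a m"
    by (simp add: g_def b_def)
  moreover have "f h = h ^ m * g h" if "\<bar>h\<bar> < r" for h
    using sums_unique2[OF tail[OF that] sums_mult2[OF summable_sums[OF summable[OF that]]]]
    by (simp add: g_def mult.commute)
  ultimately show ?thesis
    using that by blast
qed

lemma isCont_abs_between:
  fixes g :: "real \<Rightarrow> real"
  assumes "isCont g 0" "g 0 \<noteq> 0"
  obtains d where "d > 0" "\<And>h. \<bar>h\<bar> < d \<Longrightarrow> \<bar>g 0\<bar> / 2 \<le> \<bar>g h\<bar> \<and> \<bar>g h\<bar> \<le> 2 * \<bar>g 0\<bar>"
proof -
  obtain d where "d > 0" and d: "\<And>h. dist h 0 < d \<Longrightarrow> dist (g h) (g 0) < \<bar>g 0\<bar> / 2"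
    using assms unfolding continuous_at_eps_delta by (metis half_gt_zero zero_less_abs_iff)
  have "\<bar>g 0\<bar> / 2 \<le> \<bar>g h\<bar> \<and> \<bar>g h\<bar> \<le> 2 * \<bar>g 0\<bar>" if "\<bar>h\<bar> < d" for h
    using d[of h] that unfolding dist_real_def by (intro conjI; linarith)
  then show ?thesis
    using that \<open>d > 0\<close> by blast
qed

text \<open>Near \<open>p\<close>, \<open>f - f p\<close> is at most a multiple of
  \<open>\<bar>h\<bar> ^ k\<close> and the derivative at least a multiple of
  \<open>\<bar>h\<bar> ^ (k - 1)\<close>; eliminating \<open>\<bar>h\<bar>\<close> gives the
  inequality. The last conclusion serves to bound the prefactor of the length excess uniformly in
  \<alpha>.\<close>

lemma Lojasiewicz_real_analytic:
  assumes "real_analytic f" "deriv f p = 0"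
  obtains \<gamma> C d :: real where "1 / 2 < \<gamma>" "\<gamma> \<le> 1" "C > 0" "d > 0"
    "\<And>x. \<bar>x - p\<bar> < d \<Longrightarrow> \<bar>f x - f p\<bar> \<le> C * (\<bar>deriv f x\<bar>\<^sup>2) powr \<gamma>"
    "\<And>x. \<bar>x - p\<bar> < d \<Longrightarrow> \<bar>f x\<bar> \<le> \<bar>f p\<bar> + C"
proof -
  obtain r a where "r > 0" and a: "\<And>x. \<bar>x - p\<bar> < r \<Longrightarrow> (\<lambda>n. a n * (x - p) ^ n) sums f x"
    using assms(1) unfolding real_analytic_def by metis
  define F where "F = (\<lambda>h. f (p + h) - f p)"
  define b where "b = (\<lambda>n. if n = 0 then 0 else a n)"
  have a0: "a 0 = f p"
    using sums_unique2[OF powser_sums_zero[of a]] a[of p] \<open>r > 0\<close> by simp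
  have F: "(\<lambda>n. b n * h ^ n) sums F h" if "\<bar>h\<bar> < r" for h
  proof -
    have "(\<lambda>n. a n * h ^ n) sums f (p + h)"
      using a[of "p + h"] that by simp
    moreover have "(\<lambda>n. a n * h ^ n - (if n = 0 then f p else 0)) = (\<lambda>n. b n * h ^ n)"
      by (auto simp: b_def a0)
    ultimately show ?thesis
      using sums_diff[OF _ sums_single[of 0 "\<lambda>n. f p"]] by (metis F_def)
  qed
  have F': "(F has_real_derivative (\<Sum>n. diffs b n * h ^ n)) (at h)" if "\<bar>h\<bar> < r" for h
  proof -
    obtain K where K: "\<bar>h\<bar> < K" "K < r"
      using dense[OF \<open>\<bar>h\<bar> < r\<close>] by blast
    \<comment> \<open>Termwise differentiation at \<open>h\<close> needs convergence at some
      \<open>K\<close> strictly beyond \<open>\<bar>h\<bar>\<close>.\<close>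
    have "((\<lambda>h. \<Sum>n. b n * h ^ n) has_real_derivative (\<Sum>n. diffs b n * h ^ n)) (at h)"
      by (rule termdiffs_strong[where K = K])
        (use K F[of K] in \<open>auto intro: sums_summable\<close>)
    then show ?thesis
    proof (rule has_field_derivative_transform_within_open)
      show "open {-r<..<r}" "h \<in> {-r<..<r}"
        using that by auto
      show "\<And>y. y \<in> {-r<..<r} \<Longrightarrow> (\<Sum>n. b n * y ^ n) = F y"
        using F by (intro sums_unique[symmetric]) auto
    qed
  qed
  have f': "deriv f (p + h) = (\<Sum>n. diffs b n * h ^ n)" if "\<bar>h\<bar> < r" for h
  proof -
    have "((\<lambda>h. F h + f p) has_real_derivative (\<Sum>n. diffs b n * h ^ n)) (at h)"
      using F'[OF that] by (auto intro!: derivative_eq_intros)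
    then have "((\<lambda>h. f (h + p)) has_real_derivative (\<Sum>n. diffs b n * h ^ n)) (at h)"
      by (simp add: F_def add.commute)
    then have "(f has_real_derivative (\<Sum>n. diffs b n * h ^ n)) (at (h + p))"
      by (simp add: DERIV_shift)
    then show ?thesis
      by (simp add: DERIV_imp_deriv add.commute)
  qed
  show ?thesis
  proof (cases "\<forall>n. b n = 0")
    \<comment> \<open>Here \<open>f\<close> is constant near \<open>p\<close>, so the left-hand side
      is 0 and any admissible exponent and constant will do.\<close>
    case True
    have const: "f x = f p" if "\<bar>x - p\<bar> < r" for x
      using sums_unique[OF F[OF that]] True by (simp add: F_def)
    show ?thesis
    proof (rule that[of 1 1 r])
      fix x assume "\<bar>x - p\<bar> < r"
      from const[OF this]
      show "\<bar>f x - f p\<bar> \<le> 1 * (\<bar>deriv f x\<bar>\<^sup>2) powr 1" "\<bar>f x\<bar> \<le> \<bar>f p\<bar> + 1"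
        by simp_all
    qed (use \<open>r > 0\<close> in auto)
  next
    case False
    define k where "k = (LEAST n. b n \<noteq> 0)"
    have bk: "b k \<noteq> 0"
      unfolding k_def using False LeastI_ex[of "\<lambda>n. b n \<noteq> 0"] by blast
    have b_less: "b i = 0" if "i < k" for i
      using that not_less_Least unfolding k_def by blast
    \<comment> \<open>Criticality of \<open>p\<close> enters here: at \<open>h = 0\<close> the
      differentiated series reduces to \<open>b 1\<close>. Together with \<open>b 0 = 0\<close> it
      forces \<open>k \<ge> 2\<close>.\<close>
    have "b 1 = 0"
      using f'[of 0] \<open>r > 0\<close> assms(2) by (simp add: diffs_def)
    moreover have "b 0 = 0"
      by (simp add: b_def)
    ultimately have "k \<noteq> 1" "k \<noteq> 0"
      using bk by metis+
    then have k: "k \<ge> 2"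
      by linarith
    have dF: "(\<lambda>n. diffs b n * h ^ n) sums deriv f (p + h)" if "\<bar>h\<bar> < r" for h
    proof -
      have "summable (\<lambda>n. diffs b n * h ^ n)"
        by (rule termdiff_converges[where K = r])
          (use that F in \<open>auto intro: sums_summable\<close>)
      then show ?thesis
        using f'[OF that] by (simp add: summable_sums)
    qed
    obtain g where g: "isCont g 0" "g 0 = b k" "\<And>h. \<bar>h\<bar> < r \<Longrightarrow> F h = h ^ k * g h"
      using power_series_factor_power[OF \<open>r > 0\<close> F b_less] by blast
    \<comment> \<open>Since \<open>diffs b i\<close> is \<open>(i + 1) * b (i + 1)\<close>, the
      order of vanishing drops by exactly one, and the new leading coefficient
      \<open>k * b k\<close> is nonzero.\<close>
    have diffs0: "diffs b i = 0" if "i < k - 1" for i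
      using that by (simp add: diffs_def b_less)
    obtain q where q: "isCont q 0" "q 0 = diffs b (k - 1)"
        "\<And>h. \<bar>h\<bar> < r \<Longrightarrow> deriv f (p + h) = h ^ (k - 1) * q h"
      using power_series_factor_power[OF \<open>r > 0\<close> dF diffs0] by blast
    have "q 0 \<noteq> 0" "g 0 \<noteq> 0"
      using k bk by (auto simp: q g diffs_def)
    obtain d1 where d1: "d1 > 0" "\<And>h. \<bar>h\<bar> < d1 \<Longrightarrow> \<bar>g h\<bar> \<le> 2 * \<bar>g 0\<bar>"
      using isCont_abs_between[OF g(1) \<open>g 0 \<noteq> 0\<close>] by metis
    obtain d2 where d2: "d2 > 0" "\<And>h. \<bar>h\<bar> < d2 \<Longrightarrow> \<bar>q 0\<bar> / 2 \<le> \<bar>q h\<bar>"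
      using isCont_abs_between[OF q(1) \<open>q 0 \<noteq> 0\<close>] by metis
    define A B where "A = 2 * \<bar>g 0\<bar>" and "B = \<bar>q 0\<bar> / 2"
    \<comment> \<open>Chosen so that \<open>(k - 1) * (2 * \<gamma>) = k\<close>. It always exceeds
      1/2, and it is at most 1 because \<open>k \<ge> 2\<close>.\<close>
    define \<gamma> where "\<gamma> = real k / (2 * (real k - 1))"
    \<comment> \<open>The second argument of \<open>max\<close> is what the Lojasiewicz inequality
      needs, the first what the local bound on \<open>f\<close> needs. The 1 in \<open>d\<close>
      below makes \<open>\<bar>h\<bar> ^ k \<le> 1\<close>.\<close>
    define C where "C = max A (A / B powr (2 * \<gamma>))"
    define d where "d = Min {1, r, d1, d2}"
    have AB: "A > 0" "B > 0"
      using \<open>q 0 \<noteq> 0\<close> \<open>g 0 \<noteq> 0\<close> by (auto simp: A_def B_def)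
    have \<gamma>: "1 / 2 < \<gamma>" "\<gamma> \<le> 1"
      using k by (auto simp: \<gamma>_def field_simps)
    have bounds: "\<bar>F h\<bar> \<le> A * \<bar>h\<bar> ^ k" "B * \<bar>h\<bar> ^ (k - 1) \<le> \<bar>deriv f (p + h)\<bar>" if "\<bar>h\<bar> < d" for h
    proof -
      have h: "\<bar>h\<bar> < r" "\<bar>h\<bar> < d1" "\<bar>h\<bar> < d2"
        using that by (auto simp: d_def)
      show "\<bar>F h\<bar> \<le> A * \<bar>h\<bar> ^ k"
        using mult_right_mono[OF d1(2)[OF h(2)], of "\<bar>h\<bar> ^ k"]
        by (simp add: g(3)[OF h(1)] A_def abs_mult power_abs mult.commute)
      show "B * \<bar>h\<bar> ^ (k - 1) \<le> \<bar>deriv f (p + h)\<bar>"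
        using mult_right_mono[OF d2(2)[OF h(3)], of "\<bar>h\<bar> ^ (k - 1)"]
        by (simp add: q(3)[OF h(1)] B_def abs_mult power_abs mult.commute)
    qed
    have \<gamma>_exponent: "real (k - 1) * (2 * \<gamma>) = real k"
      using k by (simp add: \<gamma>_def field_simps)
    have loj: "\<bar>F h\<bar> \<le> C * (\<bar>deriv f (p + h)\<bar>\<^sup>2) powr \<gamma>" if "\<bar>h\<bar> < d" for h
    \<comment> \<open>Rewriting natural powers as \<open>powr\<close> requires a positive base, so
      the centre, where \<open>F\<close> vanishes, is treated apart.\<close>
    proof (cases "h = 0")
      case False
      have "\<bar>h\<bar> ^ k = (\<bar>h\<bar> ^ (k - 1)) powr (2 * \<gamma>)"
        using False \<gamma>_exponent by (simp add: powr_powr flip: powr_realpow)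
      then have "A * \<bar>h\<bar> ^ k = A / B powr (2 * \<gamma>) * (B * \<bar>h\<bar> ^ (k - 1)) powr (2 * \<gamma>)"
        using AB by (simp add: powr_mult)
      also have "\<dots> \<le> C * \<bar>deriv f (p + h)\<bar> powr (2 * \<gamma>)"
        using AB \<gamma> bounds(2)[OF that] by (intro mult_mono powr_mono2) (auto simp: C_def)
      also have "\<bar>deriv f (p + h)\<bar> powr (2 * \<gamma>) = (\<bar>deriv f (p + h)\<bar>\<^sup>2) powr \<gamma>"
        by (metis abs_ge_zero powr_numeral powr_powr)
      finally show ?thesis
        using bounds(1)[OF that] by simp
    qed (use AB in \<open>simp add: F_def C_def le_max_iff_disj\<close>)
    have bound: "\<bar>F h\<bar> \<le> C" if "\<bar>h\<bar> < d" for h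
    proof -
      have "A * \<bar>h\<bar> ^ k \<le> A * 1"
        using AB that by (intro mult_left_mono power_le_one) (auto simp: d_def)
      then show ?thesis
        using bounds(1)[OF that] by (simp add: C_def)
    qed
    show ?thesis
    proof (rule that[of \<gamma> C d])
      show "1 / 2 < \<gamma>" "\<gamma> \<le> 1" "C > 0" "d > 0"
        using \<gamma> AB \<open>r > 0\<close> d1 d2 by (auto simp: C_def d_def)
      fix x :: real assume x: "\<bar>x - p\<bar> < d"
      show "\<bar>f x - f p\<bar> \<le> C * (\<bar>deriv f x\<bar>\<^sup>2) powr \<gamma>"
        using loj[OF x] by (simp add: F_def)
      show "\<bar>f x\<bar> \<le> \<bar>f p\<bar> + C"
        using bound[OF x] by (simp add: F_def)
    qed
  qed
qed

section \<open>Length and curvature of periodic graphs\<close>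

lemma set_integrable_01:
  fixes f :: "real \<Rightarrow> real"
  assumes "continuous_on UNIV f"
  shows "set_integrable lborel {0<..<1} f"
  by (rule set_integrable_subset[OF borel_integrable_atLeastAtMost'[of 0 1]])
    (use assms in \<open>auto intro: continuous_on_subset\<close>)

lemma set_integral_01_mono:
  fixes f g :: "real \<Rightarrow> real"
  assumes "continuous_on UNIV f" "continuous_on UNIV g" "\<And>x. x \<in> {0<..<1} \<Longrightarrow> f x \<le> g x"
  shows "(LBINT x:{0<..<1}. f x) \<le> (LBINT x:{0<..<1}. g x)"
  using assms by (intro set_integral_mono set_integrable_01)

lemma set_integral_01_const: "(LBINT x:{0<..<1 :: real}. c) = (c :: real)"
  by (simp add: set_lebesgue_integral_def)

text \<open>Jensen's inequality on an interval of measure one: integrate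
  \<open>(f x - I)\<^sup>2 \<ge> 0\<close>, where \<open>I\<close> is the mean of
  \<open>f\<close>.\<close>

lemma set_integral_01_square_le:
  fixes f :: "real \<Rightarrow> real"
  assumes f: "continuous_on UNIV f"
  shows "(LBINT x:{0<..<1}. f x)\<^sup>2 \<le> (LBINT x:{0<..<1}. (f x)\<^sup>2)"
proof -
  define I where "I = (LBINT x:{0<..<1}. f x)"
  have "I\<^sup>2 = 2 * I * (LBINT x:{0<..<1}. f x) - (LBINT x:{0<..<1 :: real}. I\<^sup>2)"
    by (simp add: set_integral_01_const power2_eq_square flip: I_def)
  also have "\<dots> = (LBINT x:{0<..<1}. 2 * I * f x - I\<^sup>2)"
    by (subst set_integral_diff(2))
      (auto intro!: set_integrable_01 continuous_intros f)
  also have "\<dots> \<le> (LBINT x:{0<..<1}. (f x)\<^sup>2)"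
  proof (rule set_integral_01_mono)
    show "2 * I * f x - I\<^sup>2 \<le> (f x)\<^sup>2" for x
      using zero_le_power2[of "f x - I"] by (simp add: power2_diff algebra_simps)
  qed (intro continuous_intros f)+
  finally show ?thesis
    by (simp add: I_def)
qed

text \<open>Integrating \<open>z\<close> from the zero \<open>c\<close> to \<open>x\<close> bounds
  \<open>\<bar>w x\<bar>\<close> by the integral of \<open>\<bar>z\<bar>\<close>; the preceding
  lemma then passes to squares with constant 1.\<close>

lemma square_le_integral_deriv_square:
  fixes w z :: "real \<Rightarrow> real"
  assumes w: "\<And>x. (w has_real_derivative z x) (at x)"
    and z: "continuous_on UNIV z"
    and "c \<in> {0..1}" "w c = 0" "x \<in> {0..1}"
  shows "(w x)\<^sup>2 \<le> (LBINT t:{0<..<1}. (z t)\<^sup>2)"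
proof -
  define J where "J = (LBINT t:{0<..<1}. \<bar>z t\<bar>)"
  \<comment> \<open>The fundamental theorem of calculus is applied with the gauge integral, so
    \<open>J\<close> is carried over from the Lebesgue integral.\<close>
  have J: "J = integral {0..1} (\<lambda>t. \<bar>z t\<bar>)"
    unfolding J_def
    by (subst set_borel_integral_eq_integral)
      (auto intro!: set_integrable_01 continuous_intros z simp: integral_open_interval_real)
  have "\<bar>w b - w a\<bar> \<le> J" if "0 \<le> a" "a \<le> b" "b \<le> 1" for a b
  proof -
    have "(z has_integral w b - w a) {a..b}"
      using that w by (intro fundamental_theorem_of_calculus)
        (auto intro: has_field_derivative_at_within simp flip: has_real_derivative_iff_has_vector_derivative)
    then have "w b - w a = integral {a..b} z"
      by (simp add: integral_unique)
    also have "norm \<dots> \<le> integral {a..b} (\<lambda>t. \<bar>z t\<bar>)"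
      using z by (intro integral_norm_bound_integral integrable_continuous_interval continuous_intros)
        (auto intro: continuous_on_subset)
    finally have "\<bar>w b - w a\<bar> \<le> integral {a..b} (\<lambda>t. \<bar>z t\<bar>)"
      by simp
    also have "\<dots> \<le> J"
      unfolding J using that z
      by (intro integral_subset_le integrable_continuous_interval continuous_intros)
        (auto intro: continuous_on_subset)
    finally show ?thesis .
  qed
  \<comment> \<open>The zero \<open>c\<close> may lie on either side of \<open>x\<close>.\<close>
  from this[of x c] this[of c x] have "\<bar>w x\<bar> \<le> J"
    using assms(3-5) by (cases "x \<le> c") auto
  then have "(w x)\<^sup>2 \<le> J\<^sup>2"
    by (metis abs_ge_zero power2_abs power_mono)
  also have "\<dots> \<le> (LBINT t:{0<..<1}. \<bar>z t\<bar>\<^sup>2)"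
    unfolding J_def by (intro set_integral_01_square_le continuous_intros z)
  finally show ?thesis
    by simp
qed

section \<open>Slope, curvature and length of a periodic graph\<close>

lemma has_real_derivative_graph_slope:
  assumes "(w has_real_derivative z) (at x)"
  shows "((\<lambda>x. w x / sqrt (1 + (w x)\<^sup>2)) has_real_derivative z / sqrt (1 + (w x)\<^sup>2) ^ 3) (at x)"
proof -
  define s where "s = sqrt (1 + (w x)\<^sup>2)"
  have pos: "0 < 1 + (w x)\<^sup>2"
    by (simp add: add_pos_nonneg)
  then have s: "s > 0" "s\<^sup>2 = 1 + (w x)\<^sup>2"
    by (auto simp: s_def)
  have sq: "((\<lambda>x. sqrt (1 + (w x)\<^sup>2)) has_real_derivative w x * z / s) (at x)"
    using assms pos unfolding s_def
    by (auto intro!: derivative_eq_intros simp: field_simps)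
  have "((\<lambda>x. w x / sqrt (1 + (w x)\<^sup>2)) has_real_derivative
      (z * s - w x * (w x * z / s)) / (s * s)) (at x)"
    using DERIV_divide[OF assms sq] s(1) by (simp add: s_def)
  \<comment> \<open>The quotient rule collapses because
    \<open>s\<^sup>2 - (w x)\<^sup>2 = 1\<close>.\<close>
  also have "(z * s - w x * (w x * z / s)) / (s * s) = z * (s\<^sup>2 - (w x)\<^sup>2) / s ^ 3"
    using s(1) by (simp add: field_simps power2_eq_square power3_eq_cube)
  also have "\<dots> = z / s ^ 3"
    by (simp add: s(2))
  finally show ?thesis
    by (simp add: s_def)
qed

lemma smooth_realD:
  assumes "smooth_real v"
  shows "(v has_real_derivative deriv v x) (at x)"
    and "(deriv v has_real_derivative deriv (deriv v) x) (at x)"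
    and "continuous_on UNIV (deriv v)"
    and "continuous_on UNIV (deriv (deriv v))"
proof -
  have *: "(deriv ^^ n) v field_differentiable at x" for n x
    using assms by (simp add: smooth_real_def)
  show "(v has_real_derivative deriv v x) (at x)"
    "(deriv v has_real_derivative deriv (deriv v) x) (at x)"
    using *[of 0] *[of 1] by (auto simp: field_differentiable_derivI)
  show "continuous_on UNIV (deriv v)" "continuous_on UNIV (deriv (deriv v))"
    using *[of 1] *[of 2]
    by (auto simp: numeral_2_eq_2 continuous_on_eq_continuous_at
        intro: field_differentiable_imp_continuous_at)
qed

text \<open>The witness \<open>Z\<close> is the integral of the squared second derivative. It links
  length excess and curvature, so that the final estimate involves neither derivatives of
  \<open>u\<close> nor its periodic extension.\<close>

lemma graph_length_curvature_bounds:
  assumes "smooth_periodic_01 u" "H2_per_ave_norm u < \<delta>" "\<delta> \<le> 1"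
  obtains Z where "0 \<le> Z" "Z \<le> 1" "1 \<le> graph_length u" "graph_length u \<le> 1 + Z / 2"
    "Z \<le> 8 * (L2_norm_01 (graph_curvature u))\<^sup>2"
proof -
  obtain v where v: "smooth_real v" "\<And>x. v (x + 1) = v x" "\<And>x. x \<in> {0<..<1} \<Longrightarrow> u x = v x"
    using assms(1) unfolding smooth_periodic_01_def by blast
  note smooth = smooth_realD[OF v(1)]
  define w z where "w = deriv v" and "z = deriv w"
  have w: "(w has_real_derivative z x) (at x)" for x
    using smooth(2) by (simp add: w_def z_def)
  have cont: "continuous_on UNIV w" "continuous_on UNIV z"
    using smooth by (auto simp: w_def z_def)
  \<comment> \<open>\<open>u\<close> is arbitrary outside the open interval, but derivatives at its
    points depend only on values nearby, so those of \<open>v\<close> can replace those of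
    \<open>u\<close>.\<close>
  have cong: "deriv f x = deriv g x"
    if "\<And>x. x \<in> {0<..<1} \<Longrightarrow> f x = g x" "x \<in> {0<..<1}" for f g :: "real \<Rightarrow> real" and x
    by (rule deriv_cong_ev[OF eventually_nhds[THEN iffD2]])
      (use that in \<open>auto intro!: exI[of _ "{0<..<1}"]\<close>)
  have u1: "deriv u x = w x" if "x \<in> {0<..<1}" for x
    unfolding w_def using that v(3) by (intro cong) auto
  have u2: "deriv (deriv u) x = z x" if "x \<in> {0<..<1}" for x
    unfolding z_def using that u1 by (intro cong) auto
  define s where "s = (\<lambda>x. sqrt (1 + (w x)\<^sup>2))"
  have s1: "s x \<ge> 1" for x
    by (simp add: s_def)
  \<comment> \<open>The inequality of arithmetic and geometric means for 1 and
    \<open>1 + (w x)\<^sup>2\<close>.\<close>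
  have s2: "s x \<le> 1 + (w x)\<^sup>2 / 2" for x
    unfolding s_def using arith_geo_mean_sqrt[of 1 "1 + (w x)\<^sup>2"] by simp
  have conts: "continuous_on UNIV s"
    unfolding s_def by (intro continuous_intros cont)
  have curv: "graph_curvature u x = z x / s x ^ 3" if "x \<in> {0<..<1}" for x
  proof -
    have "graph_curvature u x = deriv (\<lambda>x. w x / sqrt (1 + (w x)\<^sup>2)) x"
      unfolding graph_curvature_def using that u1 by (intro cong) auto
    also have "\<dots> = z x / s x ^ 3"
      unfolding s_def by (intro DERIV_imp_deriv has_real_derivative_graph_slope w)
    finally show ?thesis .
  qed
  have L: "graph_length u = (LBINT x:{0<..<1}. s x)"
    unfolding graph_length_def
    by (intro set_lebesgue_integral_cong) (auto simp: u1 s_def)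
  define Z where "Z = (LBINT x:{0<..<1}. (z x)\<^sup>2)"
  have nonneg: "0 \<le> (LBINT x:{0<..<1}. (f x)\<^sup>2)" for f :: "real \<Rightarrow> real"
    unfolding set_lebesgue_integral_def by (intro integral_nonneg_AE) auto
  have "Z \<ge> 0"
    unfolding Z_def by (rule nonneg)
  have "Z \<le> 1"
  proof -
    have Z: "Z = (LBINT x:{0<..<1}. (deriv (deriv u) x)\<^sup>2)"
      unfolding Z_def by (intro set_lebesgue_integral_cong) (auto simp: u2)
    have "sqrt Z \<le> H2_per_ave_norm u"
      unfolding H2_per_ave_norm_def Z using nonneg[of "deriv u"] by simp
    then have "sqrt Z \<le> 1"
      using assms(2,3) by linarith
    then show ?thesis
      by simp
  qed
  \<comment> \<open>Periodicity is used here: Rolle's theorem supplies the zero of the slope, with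
    no need to integrate \<open>w\<close>.\<close>
  have "v 0 = v 1"
    using v(2)[of 0] by simp
  then obtain c where c: "0 < c" "c < 1" "w c = 0"
    using Rolle[of 0 1 v] smooth(1) unfolding w_def
    by (metis DERIV_isCont DERIV_imp_deriv UNIV_I continuous_at_imp_continuous_on
        real_differentiable_def zero_less_one)
  have wZ: "(w x)\<^sup>2 \<le> Z" if "x \<in> {0<..<1}" for x
    unfolding Z_def by (rule square_le_integral_deriv_square[OF w cont(2), of c]) (use c that in auto)
  show ?thesis
  proof (rule that[of Z])
    show "1 \<le> graph_length u"
      using set_integral_01_mono[of "\<lambda>_. 1" s] s1 conts
      by (simp add: L set_integral_01_const)
    have "s x \<le> 1 + Z / 2" if "x \<in> {0<..<1}" for x
      using s2[of x] wZ[OF that] by simp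
    then show "graph_length u \<le> 1 + Z / 2"
      using set_integral_01_mono[of s "\<lambda>_. 1 + Z / 2"] conts
      by (simp add: L set_integral_01_const)
    \<comment> \<open>The 8 is \<open>2 ^ 3\<close>: the slope bound gives
      \<open>(s x)\<^sup>2 \<le> 1 + Z \<le> 2\<close>, and the squared curvature has denominator
      \<open>((s x)\<^sup>2) ^ 3\<close>.\<close>
    have "(z x)\<^sup>2 / 8 \<le> (z x / s x ^ 3)\<^sup>2" if "x \<in> {0<..<1}" for x
    proof -
      have "(s x)\<^sup>2 \<le> 2"
        using wZ[OF that] \<open>Z \<le> 1\<close> by (simp add: s_def)
      then have "((s x)\<^sup>2) ^ 3 \<le> 2 ^ 3"
        by (intro power_mono) auto
      then have "(s x ^ 3)\<^sup>2 \<le> 8"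
        by (simp flip: power_mult)
      moreover have "(s x ^ 3)\<^sup>2 > 0"
        using s1[of x] by simp
      ultimately have "(z x)\<^sup>2 / 8 \<le> (z x)\<^sup>2 / (s x ^ 3)\<^sup>2"
        by (intro divide_left_mono) auto
      then show ?thesis
        by (simp add: power_divide)
    qed
    moreover have "s x \<noteq> 0" for x
      using s1[of x] by linarith
    ultimately have "Z / 8 \<le> (LBINT x:{0<..<1}. (z x / s x ^ 3)\<^sup>2)"
      using set_integral_01_mono[of "\<lambda>x. (z x)\<^sup>2 / 8" "\<lambda>x. (z x / s x ^ 3)\<^sup>2"] conts cont
      by (simp add: Z_def continuous_intros)
    also have "\<dots> = (LBINT x:{0<..<1}. (graph_curvature u x)\<^sup>2)"
      by (intro set_lebesgue_integral_cong) (auto simp: curv)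
    also have "\<dots> = (L2_norm_01 (graph_curvature u))\<^sup>2"
      unfolding L2_norm_01_def by (simp add: nonneg)
    finally show "Z \<le> 8 * (L2_norm_01 (graph_curvature u))\<^sup>2"
      by simp
  qed fact+
qed

section \<open>Combination of the length estimate with the Lojasiewicz inequality\<close>

theorem theorem3p7:
  fixes \<sigma> :: "real \<Rightarrow> real" and c0 \<alpha>bar :: real
  assumes "real_analytic \<sigma>"
    and "c0 > 0" and "\<forall>x. \<sigma> x \<ge> c0"
    and "deriv \<sigma> \<alpha>bar = 0"
  shows "\<exists>\<gamma> C \<delta> :: real. 1 / 2 < \<gamma> \<and> \<gamma> \<le> 1 \<and> C > 0 \<and> \<delta> > 0 \<and>
    (\<forall>(u :: real \<Rightarrow> real) (\<alpha> :: real).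
       smooth_periodic_01 u \<longrightarrow> H2_per_ave_norm u < \<delta> \<longrightarrow> \<bar>\<alpha> - \<alpha>bar\<bar> < \<delta> \<longrightarrow>
       \<sigma> \<alpha> * graph_length u \<le> \<sigma> \<alpha>bar +
         C * ((\<sigma> \<alpha>)\<^sup>2 * (L2_norm_01 (graph_curvature u))\<^sup>2
              + \<bar>deriv \<sigma> \<alpha>\<bar>\<^sup>2 * (graph_length u)\<^sup>2) powr \<gamma>)"
proof -
  obtain \<gamma> C d :: real where \<gamma>: "1 / 2 < \<gamma>" "\<gamma> \<le> 1" and "C > 0" "d > 0"
    and loj: "\<And>x. \<bar>x - \<alpha>bar\<bar> < d \<Longrightarrow> \<bar>\<sigma> x - \<sigma> \<alpha>bar\<bar> \<le> C * (\<bar>deriv \<sigma> x\<bar>\<^sup>2) powr \<gamma>"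
    and bound: "\<And>x. \<bar>x - \<alpha>bar\<bar> < d \<Longrightarrow> \<bar>\<sigma> x\<bar> \<le> \<bar>\<sigma> \<alpha>bar\<bar> + C"
    using Lojasiewicz_real_analytic[OF assms(1,4)] by metis
  define M where "M = \<bar>\<sigma> \<alpha>bar\<bar> + C"
  \<comment> \<open>The first summand pays for \<open>\<sigma> \<alpha> * (L - 1)\<close>, the
    second for \<open>\<sigma> \<alpha> - \<sigma> \<alpha>bar\<close>.\<close>
  define C' where "C' = M / 2 * (8 / c0\<^sup>2) powr \<gamma> + C"
  have "M > 0"
    using \<open>C > 0\<close> by (simp add: M_def add_nonneg_pos)
  then have "C' > 0"
    using \<open>C > 0\<close> by (simp add: C'_def add_nonneg_pos)
  have main: "\<sigma> \<alpha> * graph_length u \<le> \<sigma> \<alpha>bar +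
         C' * ((\<sigma> \<alpha>)\<^sup>2 * (L2_norm_01 (graph_curvature u))\<^sup>2
              + \<bar>deriv \<sigma> \<alpha>\<bar>\<^sup>2 * (graph_length u)\<^sup>2) powr \<gamma>"
    \<comment> \<open>In the radius \<open>min 1 d\<close>, the 1 ensures \<open>Z \<le> 1\<close>
      and \<open>d\<close> is the range of the Lojasiewicz inequality.\<close>
    if u: "smooth_periodic_01 u" "H2_per_ave_norm u < min 1 d" and \<alpha>: "\<bar>\<alpha> - \<alpha>bar\<bar> < min 1 d" for u \<alpha>
  proof -
    obtain Z where Z: "0 \<le> Z" "Z \<le> 1" "1 \<le> graph_length u" "graph_length u \<le> 1 + Z / 2"
        "Z \<le> 8 * (L2_norm_01 (graph_curvature u))\<^sup>2"
      using graph_length_curvature_bounds[OF u] by (metis min.cobounded1)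
    define K L where "K = (L2_norm_01 (graph_curvature u))\<^sup>2" and "L = graph_length u"
    define X where "X = (\<sigma> \<alpha>)\<^sup>2 * K + \<bar>deriv \<sigma> \<alpha>\<bar>\<^sup>2 * L\<^sup>2"
    have "K \<ge> 0"
      by (simp add: K_def)
    have \<sigma>\<alpha>: "c0 \<le> \<sigma> \<alpha>" "\<sigma> \<alpha> \<le> M"
      using assms(3) bound[of \<alpha>] \<alpha> by (auto simp: M_def)
    have "Z \<le> 8 / c0\<^sup>2 * X"
    proof -
      \<comment> \<open>The positive lower bound on \<sigma> keeps the curvature term of
        \<open>X\<close> from degenerating.\<close>
      have "c0\<^sup>2 * K \<le> X"
        unfolding X_def using \<sigma>\<alpha> \<open>c0 > 0\<close> \<open>K \<ge> 0\<close>
        by (intro add_increasing2 mult_right_mono power_mono) auto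
      then have "K \<le> X / c0\<^sup>2"
        using \<open>c0 > 0\<close> by (simp add: field_simps)
      then show ?thesis
        using Z(5) by (simp add: K_def)
    qed
    have "X \<ge> 0"
      using \<open>K \<ge> 0\<close> by (simp add: X_def)
    \<comment> \<open>This uses \<open>\<gamma> \<le> 1\<close> together with
      \<open>0 \<le> Z \<le> 1\<close>: the length excess is linear in \<open>Z\<close>, hence also
      controlled by the weaker power.\<close>
    have "Z \<le> Z powr \<gamma>"
      using powr_mono'[of \<gamma> 1 Z] \<gamma> Z by simp
    also have "\<dots> \<le> (8 / c0\<^sup>2 * X) powr \<gamma>"
      using \<open>Z \<le> 8 / c0\<^sup>2 * X\<close> \<gamma> Z by (intro powr_mono2) auto
    also have "\<dots> = (8 / c0\<^sup>2) powr \<gamma> * X powr \<gamma>"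
      by (rule powr_mult)
    finally have ZX: "Z \<le> (8 / c0\<^sup>2) powr \<gamma> * X powr \<gamma>" .
    have "\<sigma> \<alpha> * (L - 1) \<le> M * (Z / 2)"
      using Z \<sigma>\<alpha> \<open>c0 > 0\<close> by (intro mult_mono) (auto simp: L_def)
    also have "\<dots> \<le> M * ((8 / c0\<^sup>2) powr \<gamma> * X powr \<gamma> / 2)"
      using ZX \<open>M > 0\<close> by (intro mult_left_mono divide_right_mono) auto
    finally have part1: "\<sigma> \<alpha> * (L - 1) \<le> M / 2 * (8 / c0\<^sup>2) powr \<gamma> * X powr \<gamma>"
      by (simp add: mult.assoc)
    \<comment> \<open>Since \<open>L \<ge> 1\<close>, the factor \<open>L\<^sup>2\<close> only
      enlarges the derivative term.\<close>
    have "\<bar>deriv \<sigma> \<alpha>\<bar>\<^sup>2 * 1 \<le> \<bar>deriv \<sigma> \<alpha>\<bar>\<^sup>2 * L\<^sup>2"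
      using Z(3) by (intro mult_left_mono) (auto simp: L_def)
    then have "\<bar>deriv \<sigma> \<alpha>\<bar>\<^sup>2 \<le> X"
      using \<open>K \<ge> 0\<close> unfolding X_def by (intro add_increasing) auto
    then have "C * (\<bar>deriv \<sigma> \<alpha>\<bar>\<^sup>2) powr \<gamma> \<le> C * X powr \<gamma>"
      using \<gamma> \<open>C > 0\<close> by (intro mult_left_mono powr_mono2) auto
    then have part2: "\<sigma> \<alpha> - \<sigma> \<alpha>bar \<le> C * X powr \<gamma>"
      using loj[of \<alpha>] \<alpha> by linarith
    have "\<sigma> \<alpha> * L \<le> \<sigma> \<alpha>bar + C' * X powr \<gamma>"
      using part1 part2 by (simp add: C'_def algebra_simps)
    then show ?thesis
      by (simp add: X_def K_def L_def)
  qed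
  show ?thesis
    using \<gamma> \<open>C' > 0\<close> \<open>d > 0\<close> main
    by (intro exI[of _ \<gamma>] exI[of _ C'] exI[of _ "min 1 d"]) auto
qed

end
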